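(* Let $f=h+\overline{g}\in\mathcal{F}_0$ with $h(z)=z+\sum_{n=2}^\infty a_nz^n$ and $g(z)=\sum_{n=1}^\infty b_nz^n$. Then $$|b_n|\le 1\quad\text{for all } n\ge 1.$$ The estimate is best possible, i.e. for each $n\ge1$ the constant $1$ cannot be replaced by any smaller constant valid for all $f\in\mathcal{F}_0$.
   Context: $\mathbb{D}=\{z\in\mathbb{C}:|z|<1\}$. $\mathcal{H}$ is the class of all complex-valued harmonic mappings $f=h+\overline{g}$ in $\mathbb{D}$ with $h,g$ analytic in $\mathbb{D}$ and $h(0)=h'(0)-1=g(0)=0$. $Aut(\mathbb{D})=\{e^{i\theta}\frac{z-a}{1-\overline{a}z}: a\in\mathbb{D},\ \theta\in\mathbb{R}\}$. $\mathcal{F}_0$ is the class of all $f=h+\overline{g}\in\mathcal{H}$ such that $h'\ne 0$ in $\mathbb{D}$, $$\mathrm{Re}\left(1+\frac{zh''(z)}{h'(z)}\right)>0\quad\text{for all } z\in\mathbb{D},$$ and the dilatation $\omega_f=g'/h'$ belongs to $Aut(\mathbb{D})$. *)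

theory Defs
  imports "HOL-Complex_Analysis.Complex_Analysis"
begin

abbreviation unit_disc :: "complex set"
  where "unit_disc \<equiv> ball 0 1"

text \<open>Functions on the disc are total functions on \<^typ>\<open>complex\<close>; their values outside
  \<^const>\<open>unit_disc\<close> are irrelevant, and equalities of functions are required on the disc only.\<close>

text \<open>The decomposition \<open>f = h + cnj g\<close> with the normalisation
  \<open>h(0) = h'(0) - 1 = g(0) = 0\<close>. The normalisation makes \<open>h\<close> and \<open>g\<close> unique on the disc,
  so the existential quantifiers in \<open>class_H\<close> and \<open>class_F0\<close> leave no freedom.\<close>

definition harmonic_decomp ::
  "(complex \<Rightarrow> complex) \<Rightarrow> (complex \<Rightarrow> complex) \<Rightarrow> (complex \<Rightarrow> complex) \<Rightarrow> bool"
  where "harmonic_decomp f h g \<longleftrightarrow>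
    h holomorphic_on unit_disc \<and> g holomorphic_on unit_disc \<and>
    h 0 = 0 \<and> deriv h 0 - 1 = 0 \<and> g 0 = 0 \<and>
    (\<forall>z\<in>unit_disc. f z = h z + cnj (g z))"

definition class_H :: "(complex \<Rightarrow> complex) set"
  where "class_H = {f. \<exists>h g. harmonic_decomp f h g}"

text \<open>\<open>Moebius_function \<theta> a z = exp (\<i> * \<theta>) * (z - a) / (1 - cnj a * z)\<close> with real \<open>\<theta>\<close>.\<close>

definition Aut_disc :: "(complex \<Rightarrow> complex) set"
  where "Aut_disc = {Moebius_function \<theta> a |\<theta> a. a \<in> unit_disc}"

definition class_F0 :: "(complex \<Rightarrow> complex) set"
  where "class_F0 = {f \<in> class_H. \<exists>h g. harmonic_decomp f h g \<and>
    (\<forall>z\<in>unit_disc. deriv h z \<noteq> 0) \<and>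
    (\<forall>z\<in>unit_disc. Re (1 + z * deriv (deriv h) z / deriv h z) > 0) \<and>
    (\<exists>\<phi>\<in>Aut_disc. \<forall>z\<in>unit_disc. deriv g z / deriv h z = \<phi> z)}"

text \<open>\<open>h(z) = z + (\<Sum>n\<ge>2. a n * z^n)\<close> and \<open>g(z) = (\<Sum>n\<ge>1. b n * z^n)\<close> on the disc;
  \<open>a 0\<close>, \<open>a 1\<close> and \<open>b 0\<close> play no role.\<close>

definition power_series_coeffs ::
  "(complex \<Rightarrow> complex) \<Rightarrow> (complex \<Rightarrow> complex) \<Rightarrow> (nat \<Rightarrow> complex) \<Rightarrow> (nat \<Rightarrow> complex) \<Rightarrow> bool"
  where "power_series_coeffs h g a b \<longleftrightarrow>
    (\<forall>z\<in>unit_disc. (\<lambda>n. a (n + 2) * z ^ (n + 2)) sums (h z - z)) \<and>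
    (\<forall>z\<in>unit_disc. (\<lambda>n. b (n + 1) * z ^ (n + 1)) sums g z)"

end

theory Submission
  imports Defs
begin

text \<open>
  Let \<open>f = h + cnj g\<close> be in the class, with dilatation \<open>\<omega>\<close>, so that \<open>g' = \<omega> h'\<close> and \<open>\<bar>\<omega>\<bar> \<le> 1\<close>.
  The idea is that the convex function \<open>h\<close> is an average of the half-plane maps \<open>z / (1 - x z)\<close> with
  \<open>\<bar>x\<bar> = 1\<close>. For one such map, \<open>h'(z) = 1 / (1 - x z)\<^sup>2 = (\<Sum>j. (j + 1) (x z) ^ j)\<close>, and \<open>n b\<^sub>n\<close> is the sum
  \<open>(\<Sum>j<n. (j + 1) x ^ j \<omega>\<^sub>n\<^sub>-\<^sub>1\<^sub>-\<^sub>j)\<close> in the Taylor coefficients of \<open>\<omega>\<close>. Up to a unimodular factor this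
  is \<open>n\<close> times a Fejer mean of \<open>\<omega>\<close>, hence at most \<open>n\<close> in modulus. Averaging over \<open>x\<close> preserves the
  bound.

  The averaging is made precise without a representing measure. Jack's lemma, used twice, yields
  the theorem of Marx and Strohhaecker that \<open>Re (h z / z) > 1/2\<close> (\<open>convex_imp_half_plane\<close>). Then
  \<open>2 Re (h z / z) - 1\<close> is a probability density on each circle \<open>\<bar>z\<bar> = r\<close> that reproduces the Taylor
  coefficients of \<open>h z / z\<close>, so linear functionals of these coefficients are bounded by the
  supremum of a polynomial (\<open>half_plane_coeff_functional_bound\<close>). The Fejer estimate for the
  polynomial that arises here is \<open>Fejer_bound\<close>, and \<open>convex_dilatation_coeff_bound\<close> combines the two.

  For sharpness take \<open>h(z) = z / (1 - z)\<close> and \<open>\<omega>(z) = (z + r) / (1 + r z)\<close>. As \<open>r\<close> tends to \<open>1\<close>, \<open>g'\<close>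
  tends to \<open>h'\<close>, and in fact \<open>b\<^sub>n \<ge> r\<close> for every \<open>n\<close> (\<open>half_plane_example\<close>,
  \<open>half_plane_partner_coeff_ge\<close>).
\<close>

section \<open>Jack's lemma\<close>

text \<open>Along the ray in direction \<open>d\<close> the real part of \<open>G\<close> starts at its largest possible value \<open>1\<close>,
  so its one-sided derivative there cannot be positive.\<close>

lemma deriv_Re_le_if_dominated:
  fixes G :: "complex \<Rightarrow> complex"
  assumes G: "(G has_field_derivative c) (at 0)" and "G 0 = 1"
    and le: "\<And>\<epsilon>. \<epsilon> > 0 \<Longrightarrow> cmod (G (of_real \<epsilon> * d)) \<le> 1"
  shows "Re (c * d) \<le> 0"
proof (rule ccontr)
  assume "\<not> Re (c * d) \<le> 0"
  hence pos: "0 < Re (c * d)" by simp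
  have "((\<lambda>\<epsilon>. of_real \<epsilon> * d) has_vector_derivative d) (at 0)"
    unfolding has_vector_derivative_def
    by (auto intro!: derivative_eq_intros simp: scaleR_conv_of_real)
  moreover have "(G has_field_derivative c) (at (of_real 0 * d))" using G by simp
  ultimately have "((\<lambda>\<epsilon>. G (of_real \<epsilon> * d)) has_vector_derivative (d * c)) (at 0)"
    using field_vector_diff_chain_at[of "\<lambda>\<epsilon>. of_real \<epsilon> * d" d 0 G c] by (simp add: o_def)
  hence "((\<lambda>\<epsilon>. Re (G (of_real \<epsilon> * d))) has_real_derivative Re (c * d)) (at 0)"
    unfolding has_real_derivative_iff_has_vector_derivative mult.commute[of c]
    by (rule bounded_linear.has_vector_derivative[OF bounded_linear_Re])
  from DERIV_pos_inc_right[OF this pos] obtain \<delta> where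
    "\<delta> > 0" and \<delta>: "\<And>e. 0 < e \<Longrightarrow> e < \<delta> \<Longrightarrow> Re (G 0) < Re (G (of_real e * d))"
    by auto
  from \<delta>[of "\<delta>/2"] \<open>\<delta> > 0\<close> \<open>G 0 = 1\<close> have "1 < Re (G (of_real (\<delta>/2) * d))" by simp
  also have "\<dots> \<le> cmod (G (of_real (\<delta>/2) * d))" by (rule complex_Re_le_cmod)
  also have "\<dots> \<le> 1" using \<open>\<delta> > 0\<close> by (intro le) simp
  finally show False by simp
qed

text \<open>A point of smallest modulus among those with \<open>\<bar>w\<bar> \<ge> 1\<close> exists by compactness. Continuity on the
  closed disc through it forces \<open>\<bar>w\<bar> = 1\<close> there.\<close>

lemma first_point_of_modulus_one:
  assumes w: "w holomorphic_on unit_disc" and w0: "w 0 = 0"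
    and z1: "z1 \<in> unit_disc" "cmod (w z1) \<ge> 1"
  obtains z where "z \<in> unit_disc" "cmod (w z) = 1"
    "\<And>u. cmod u < cmod z \<Longrightarrow> cmod (w u) < 1"
    "\<And>u. cmod u \<le> cmod z \<Longrightarrow> cmod (w u) \<le> 1"
proof -
  have cont: "continuous_on (cball 0 (cmod z1)) w"
    using z1 by (intro holomorphic_on_imp_continuous_on holomorphic_on_subset[OF w]) auto
  define T where "T = {u \<in> cball 0 (cmod z1). w u \<in> - ball 0 1}"
  have "closed T" unfolding T_def
    using continuous_closed_preimage[OF cont closed_cball closed_Compl[OF open_ball[of 0 1]]]
    by (simp add: vimage_def Int_def)
  hence "compact T"
    by (rule compact_eq_bounded_closed[THEN iffD2, OF conjI, rotated])
      (auto simp: T_def intro: bounded_subset[OF bounded_cball[of 0 "cmod z1"]])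
  moreover have "z1 \<in> T" using z1 by (auto simp: T_def)
  ultimately obtain z where z: "z \<in> T" "\<And>u. u \<in> T \<Longrightarrow> cmod z \<le> cmod u"
    using continuous_attains_inf[of T cmod] by (auto intro!: continuous_intros)
  have zd: "z \<in> unit_disc" using z(1) z1 by (auto simp: T_def)
  have ge: "cmod (w z) \<ge> 1" and zz1: "cmod z \<le> cmod z1" using z(1) by (auto simp: T_def)
  have lt: "cmod (w u) < 1" if "cmod u < cmod z" for u
    using z(2)[of u] that zz1 by (force simp: T_def)
  have "z \<noteq> 0" using ge w0 by auto
  have "w ` closure (ball 0 (cmod z)) \<subseteq> cball 0 1"
  proof (rule image_closure_subset)
    show "continuous_on (closure (ball 0 (cmod z))) w"
      using zz1 \<open>z \<noteq> 0\<close> by (intro continuous_on_subset[OF cont]) auto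
    show "w ` ball 0 (cmod z) \<subseteq> cball 0 1" using lt by (fastforce intro: less_imp_le)
  qed auto
  hence le: "cmod (w u) \<le> 1" if "cmod u \<le> cmod z" for u
    using that \<open>z \<noteq> 0\<close> by (auto simp: image_subset_iff)
  have "cmod (w z) = 1" using ge le[of z] by simp
  from that[OF zd this lt le] show ?thesis .
qed

text \<open>The Schwarz lemma, applied after rescaling the disc through \<open>z\<close>, gives
  \<open>\<bar>w (z * exp s)\<bar> \<le> exp (Re s)\<close> whenever \<open>Re s \<le> 0\<close>. Hence
  \<open>G s = w (z * exp s) * exp (- s) / w z\<close> is bounded by \<open>1\<close> on the left half-plane, with \<open>G 0 = 1\<close>.
  The derivative \<open>c\<close> of \<open>G\<close> at \<open>0\<close> then satisfies \<open>Re (c * d) \<le> 0\<close> for every \<open>d\<close> with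
  \<open>Re d \<le> 0\<close>. Taking \<open>d = \<i>\<close> and \<open>d = - \<i>\<close> shows that \<open>c\<close> is real, and \<open>d = -1\<close> that it is
  nonnegative; finally \<open>k = c + 1\<close>.\<close>

lemma Jack_lemma:
  assumes w: "w holomorphic_on unit_disc" and w0: "w 0 = 0"
    and z: "z \<in> unit_disc" "cmod (w z) = 1"
    and lt: "\<And>u. cmod u < cmod z \<Longrightarrow> cmod (w u) < 1"
    and le: "\<And>u. cmod u \<le> cmod z \<Longrightarrow> cmod (w u) \<le> 1"
  obtains k :: real where "k \<ge> 1" "z * deriv w z = of_real k * w z"
proof -
  define R where "R = cmod z"
  have R: "0 < R" "R < 1" using z w0 by (auto simp: R_def)
  have wz: "w z \<noteq> 0" using z by auto
  have "(\<lambda>u. w (of_real R * u)) holomorphic_on unit_disc"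
    by (rule holomorphic_on_compose_gen[OF _ w, unfolded o_def])
      (use R in \<open>auto intro!: holomorphic_intros simp: norm_mult dest: mult_strict_mono[of R 1 _ 1]\<close>)
  hence schwarz: "cmod (w (of_real R * u)) \<le> cmod u" if "cmod u < 1" for u
    by (rule Schwarz_Lemma) (use R that w0 in \<open>auto intro!: lt simp: norm_mult R_def[symmetric]\<close>)
  have growth: "cmod (w (z * exp s)) \<le> exp (Re s)" if "Re s \<le> 0" for s
  proof (cases "Re s = 0")
    case True
    thus ?thesis using le[of "z * exp s"] by (simp add: norm_mult)
  next
    case False
    have "of_real R * (z * exp s / of_real R) = z * exp s" using R by simp
    moreover have "cmod (z * exp s / of_real R) = exp (Re s)"
      using R by (simp add: norm_mult norm_divide R_def)
    ultimately show ?thesis using schwarz[of "z * exp s / of_real R"] False that by simp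
  qed
  define G where "G = (\<lambda>s. w (z * exp s) * exp (- s) / w z)"
  define c where "c = z * deriv w z / w z - 1"
  have dw: "(w has_field_derivative deriv w z) (at (z * exp 0))"
    using z w by (simp add: holomorphic_derivI)
  have "((\<lambda>s. w (z * exp s)) has_field_derivative deriv w z * z) (at 0)"
    by (rule DERIV_chain2[where f = w and g = "\<lambda>s. z * exp s" and x = 0, OF dw])
      (auto intro!: derivative_eq_intros)
  hence "((\<lambda>s. w (z * exp s) * exp (- s) / w z) has_field_derivative
      (deriv w z * z * exp (- 0) + (exp (- 0) * - 1) * w (z * exp 0)) / w z) (at 0)"
    by (intro DERIV_cdivide DERIV_mult) (auto intro!: derivative_eq_intros)
  hence "(G has_field_derivative c) (at 0)"
    using wz by (simp add: G_def c_def field_simps)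
  moreover have "G 0 = 1" using wz by (simp add: G_def)
  moreover have "cmod (G s) \<le> 1" if "Re s \<le> 0" for s
  proof -
    have "cmod (G s) = cmod (w (z * exp s)) * exp (- Re s)"
      using z by (simp add: G_def norm_mult norm_divide)
    also have "\<dots> \<le> exp (Re s) * exp (- Re s)" using growth[OF that] by (intro mult_right_mono) auto
    finally show ?thesis by (simp flip: exp_add)
  qed
  ultimately have cd: "Re (c * d) \<le> 0" if "Re d \<le> 0" for d
    by (rule deriv_Re_le_if_dominated) (use that in \<open>auto simp: mult_nonneg_nonpos\<close>)
  have "Im c = 0" "Re c \<ge> 0" using cd[of \<i>] cd[of "- \<i>"] cd[of "- 1"] by auto
  then obtain l where l: "c = of_real l" "l \<ge> 0" by (metis complex_is_Real_iff Reals_cases Re_complex_of_real)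
  show ?thesis
  proof
    show "l + 1 \<ge> 1" using l by simp
    have "z * deriv w z = (c + 1) * w z" using wz by (simp add: c_def)
    thus "z * deriv w z = of_real (l + 1) * w z" by (simp add: l)
  qed
qed

text \<open>Jack's lemma in the form in which it proves bounds: to get \<open>\<bar>w\<bar> < 1\<close> it is enough to rule out the
  relation \<open>z w'(z) = k w(z)\<close> with \<open>k \<ge> 1\<close> at points with \<open>\<bar>w z\<bar> = 1\<close>.\<close>

lemma Jack_principle:
  assumes w: "w holomorphic_on unit_disc" and w0: "w 0 = 0"
    and no: "\<And>z k. \<lbrakk>z \<in> unit_disc; z \<noteq> 0; cmod (w z) = 1; k \<ge> (1::real); z * deriv w z = of_real k * w z\<rbrakk> \<Longrightarrow> False"
    and z: "z \<in> unit_disc"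
  shows "cmod (w z) < 1"
proof (rule ccontr)
  assume "\<not> cmod (w z) < 1"
  hence "1 \<le> cmod (w z)" by simp
  then obtain z0 where z0: "z0 \<in> unit_disc" "cmod (w z0) = 1"
    "\<And>u. cmod u < cmod z0 \<Longrightarrow> cmod (w u) < 1"
    "\<And>u. cmod u \<le> cmod z0 \<Longrightarrow> cmod (w u) \<le> 1"
    using first_point_of_modulus_one[OF w w0 z] by blast
  obtain k where k: "k \<ge> 1" "z0 * deriv w z0 = of_real k * w z0" using Jack_lemma[OF w w0 z0] by blast
  have "z0 \<noteq> 0" using z0(2) w0 by auto
  from no[OF z0(1) this z0(2) k] show False .
qed

section \<open>Convex functions and the half-plane\<close>

text \<open>The inversion \<open>u \<mapsto> 1 / u\<close> exchanges the disc of radius \<open>1\<close> about \<open>1\<close> with the half-plane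
  \<open>Re > 1/2\<close>.\<close>

lemma Re_half_iff_cmod:
  fixes u :: complex assumes "u \<noteq> 0"
  shows "Re (1 / u) > 1/2 \<longleftrightarrow> cmod (1 - u) < 1"
proof -
  have "cmod (1 - u) < 1 \<longleftrightarrow> (cmod (1 - u))\<^sup>2 < 1\<^sup>2"
    by (metis norm_ge_zero power2_less_imp_less power_strict_mono zero_le_one zero_less_numeral)
  also have "\<dots> \<longleftrightarrow> (cmod u)\<^sup>2 < 2 * Re u"
    by (simp add: cmod_power2) (simp add: power2_eq_square algebra_simps)
  also have "\<dots> \<longleftrightarrow> Re (1 / u) > 1/2"
    using assms by (simp add: Re_divide' field_simps)
  finally show ?thesis by simp
qed

text \<open>The theorem of Marx and Strohhaecker, by two applications of Jack's lemma. The first takes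
  \<open>w = 1 - h / (z h')\<close>, whose boundedness by \<open>1\<close> means \<open>Re (z h' / h) > 1/2\<close>. Writing \<open>P\<close> for
  \<open>1 + z h'' / h'\<close>, differentiation gives \<open>(1 - w) P = 1 + z w'\<close>; with \<open>\<bar>w\<bar> = 1\<close> and
  \<open>z w' = k w\<close> this makes \<open>Re P\<close> a nonpositive multiple of \<open>(k - 1) (1 - Re w)\<close>, against
  convexity (and \<open>w = 1\<close> would give \<open>0 = 1 + k\<close>). The second takes \<open>v = 1 - z / h\<close>, for which \<open>z h' / h = 1 + z v' / (1 - v)\<close>. Since
  \<open>Re (v / (1 - v)) = - 1/2\<close> on \<open>\<bar>v\<bar> = 1\<close>, a point as in Jack's lemma would give
  \<open>Re (z h' / h) \<le> 1 - k / 2 \<le> 1/2\<close>. Working with the holomorphic quotient \<open>q = h / z\<close> makes both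
  \<open>w = 1 - q / h'\<close> and \<open>v = 1 - 1 / q\<close> holomorphic at \<open>0\<close>.\<close>

lemma convex_imp_half_plane:
  assumes h: "h holomorphic_on unit_disc" and q: "q holomorphic_on unit_disc"
    and hq: "\<And>z. z \<in> unit_disc \<Longrightarrow> h z = z * q z" and q0: "q 0 = 1"
    and nz: "\<And>z. z \<in> unit_disc \<Longrightarrow> deriv h z \<noteq> 0"
    and convex: "\<And>z. z \<in> unit_disc \<Longrightarrow> Re (1 + z * deriv (deriv h) z / deriv h z) > 0"
    and z: "z \<in> unit_disc"
  shows "Re (q z) > 1/2"
proof -
  have h': "deriv h holomorphic_on unit_disc" using h by (intro holomorphic_deriv) auto
  have dh: "deriv h z = q z + z * deriv q z" if "z \<in> unit_disc" for z
  proof -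
    have "(q has_field_derivative deriv q z) (at z)" using that by (intro holomorphic_derivI[OF q]) auto
    hence "((\<lambda>z. z * q z) has_field_derivative q z + z * deriv q z) (at z)"
      by (auto intro!: derivative_eq_intros)
    hence "(h has_field_derivative q z + z * deriv q z) (at z)"
      by (rule has_field_derivative_transform_within_open[of _ _ _ unit_disc]) (use that hq in auto)
    thus ?thesis by (rule DERIV_imp_deriv)
  qed
  have starlike: "cmod (1 - q z / deriv h z) < 1" if "z \<in> unit_disc" for z
    using _ _ _ that
  proof (rule Jack_principle)
    show "(\<lambda>z. 1 - q z / deriv h z) holomorphic_on unit_disc"
      using nz by (intro holomorphic_intros q h') auto
    show "1 - q 0 / deriv h 0 = 0" using dh[of 0] q0 by simp
    fix z and k :: real
    define w where "w = 1 - q z / deriv h z"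
    define P where "P = 1 + z * deriv (deriv h) z / deriv h z"
    assume z: "z \<in> unit_disc" "z \<noteq> 0" and w1: "cmod w = 1" and k: "k \<ge> 1"
      and eq: "z * deriv (\<lambda>z. 1 - q z / deriv h z) z = of_real k * w"
    have "(q has_field_derivative deriv q z) (at z)"
      "(deriv h has_field_derivative deriv (deriv h) z) (at z)"
      using z by (auto intro!: holomorphic_derivI[OF q] holomorphic_derivI[OF h'])
    hence "((\<lambda>z. 1 - q z / deriv h z) has_field_derivative
         - ((deriv q z * deriv h z - q z * deriv (deriv h) z) / (deriv h z * deriv h z))) (at z)"
      using nz[OF z(1)] by (auto intro!: derivative_eq_intros)
    from eq[unfolded DERIV_imp_deriv[OF this], symmetric]
    have "of_real k * w = - (z * deriv q z / deriv h z) + (q z / deriv h z) * (z * deriv (deriv h) z / deriv h z)"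
      using nz[OF z(1)] by (simp add: field_simps)
    also have "z * deriv q z / deriv h z = w"
      using dh[OF z(1)] nz[OF z(1)] by (simp add: w_def field_simps)
    also have "q z / deriv h z = 1 - w" by (simp add: w_def)
    also have "z * deriv (deriv h) z / deriv h z = P - 1" by (simp add: P_def)
    finally have *: "(1 - w) * P = 1 + of_real k * w" by (simp add: algebra_simps)
    have "w \<noteq> 1"
    proof
      assume "w = 1"
      with * have "of_real (1 + k) = (0::complex)" by simp
      with k show False by (simp only: of_real_eq_0_iff)
    qed
    have "(cmod (1 - w))\<^sup>2 * Re P = Re (cnj (1 - w) * ((1 - w) * P))"
      by (simp add: complex_mult_cnj cmod_power2 mult.assoc[symmetric] mult.commute[of "cnj _"])
        (simp add: power2_eq_square)
    also have "\<dots> = (1 - k * (cmod w)\<^sup>2) + (k - 1) * Re w"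
      unfolding * by (simp add: cmod_power2) (simp add: algebra_simps power2_eq_square)
    also have "\<dots> = - (k - 1) * (1 - Re w)" using w1 by (simp add: algebra_simps)
    also have "\<dots> \<le> 0" using k complex_Re_le_cmod[of w] w1 by (intro mult_nonpos_nonneg) auto
    finally show False
      using convex[OF z(1)] \<open>w \<noteq> 1\<close> by (simp add: P_def[symmetric] mult_le_0_iff)
  qed
  have qnz: "q z \<noteq> 0" if "z \<in> unit_disc" for z using starlike[OF that] by auto
  have "cmod (1 - 1 / q z) < 1"
    using _ _ _ z
  proof (rule Jack_principle)
    show "(\<lambda>z. 1 - 1 / q z) holomorphic_on unit_disc"
      using qnz by (intro holomorphic_intros q) auto
    show "1 - 1 / q 0 = 0" using q0 by simp
    fix z and k :: real
    define v where "v = 1 - 1 / q z"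
    assume z: "z \<in> unit_disc" "z \<noteq> 0" and v1: "cmod v = 1" and k: "k \<ge> 1"
      and eq: "z * deriv (\<lambda>z. 1 - 1 / q z) z = of_real k * v"
    have v: "1 - v \<noteq> 0" "q z = 1 / (1 - v)" using qnz[OF z(1)] by (auto simp: v_def)
    have "(q has_field_derivative deriv q z) (at z)"
      using z by (auto intro!: holomorphic_derivI[OF q])
    hence "((\<lambda>z. 1 - 1 / q z) has_field_derivative deriv q z / (q z * q z)) (at z)"
      using qnz[OF z(1)] by (auto intro!: derivative_eq_intros)
    from eq[unfolded DERIV_imp_deriv[OF this]]
    have "z * deriv q z / q z = of_real k * v * q z"
      using qnz[OF z(1)] by (simp add: field_simps)
    hence "z * deriv q z / q z = of_real k * (v / (1 - v))" using v(2) by simp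
    hence expr: "deriv h z / q z = 1 + of_real k * (v / (1 - v))"
      using dh[OF z(1)] qnz[OF z(1)] by (simp add: add_divide_distrib)
    have "1/2 < Re (deriv h z / q z)"
      using starlike[OF z(1)] qnz[OF z(1)] nz[OF z(1)] Re_half_iff_cmod[of "q z / deriv h z"]
      by simp
    also have "\<dots> = 1 + k * Re (v / (1 - v))"
      unfolding expr by (simp del: times_divide_eq_right)
    also have "Re (v / (1 - v)) = - (1/2)"
    proof -
      have sq: "(Re v)\<^sup>2 + (Im v)\<^sup>2 = 1" using v1 cmod_power2[of v] by simp
      hence den: "(cmod (1 - v))\<^sup>2 = 2 - 2 * Re v"
        unfolding cmod_power2 by (simp add: power2_diff)
      hence "2 - 2 * Re v > 0" using v(1) by (metis zero_less_norm_iff zero_less_power)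
      moreover have "Re v * Re (1 - v) + Im v * Im (1 - v) = Re v - 1"
        using sq by (simp add: power2_eq_square algebra_simps)
      ultimately show ?thesis unfolding Re_divide' den by (simp add: field_simps)
    qed
    finally show False using k by simp
  qed
  hence "Re (1 / (1 / q z)) > 1/2"
    using qnz[OF z] by (subst Re_half_iff_cmod) auto
  thus ?thesis by simp
qed

section \<open>Coefficients as circle means\<close>

text \<open>Cauchy's formula for the derivatives at \<open>0\<close>, parametrised by the angle.\<close>

lemma circle_mean_coeff:
  assumes f: "f holomorphic_on unit_disc" and F: "f has_fps_expansion F" and r: "0 < r" "r < 1"
  shows "((\<lambda>t. f (of_real r * cis t) * cis (- t) ^ n) has_integral
           of_real (2 * pi * r ^ n) * fps_nth F n) {0..2*pi}"
proof -
  have "((\<lambda>u. f u / (u - 0) ^ Suc n) has_contour_integral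
          (2 * pi * \<i>) / fact n * (deriv ^^ n) f 0) (circlepath 0 r)"
    using r by (intro Cauchy_has_contour_integral_higher_derivative_circlepath
        holomorphic_on_imp_continuous_on holomorphic_on_subset[OF f]) auto
  hence "((\<lambda>t. f (of_real r * cis t) / (of_real r * cis t) ^ Suc n * of_real r * \<i> * cis t)
           has_integral 2 * pi * \<i> * fps_nth F n) {0..2*pi}"
    by (simp add: circlepath_def has_contour_integral_part_circlepath_iff fps_nth_fps_expansion[OF F])
  from has_integral_mult_right[OF this, of "of_real (r ^ n) / \<i>"]
  have "((\<lambda>t. of_real (r ^ n) / \<i> * (f (of_real r * cis t) / (of_real r * cis t) ^ Suc n * of_real r * \<i> * cis t))
           has_integral of_real (2 * pi * r ^ n) * fps_nth F n) {0..2*pi}"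
    by (simp add: mult_ac)
  moreover have "of_real (r ^ n) / \<i> * (f (of_real r * cis t) / (of_real r * cis t) ^ Suc n * of_real r * \<i> * cis t)
      = f (of_real r * cis t) * cis (- t) ^ n" for t
  proof -
    have "cis t ^ n * cis (- t) ^ n = 1" by (simp add: cis_mult flip: power_mult_distrib)
    thus ?thesis using r by (simp add: power_mult_distrib field_simps)
  qed
  ultimately show ?thesis by simp
qed

text \<open>The previous formula for \<open>z ^ m * f z\<close>. The case \<open>n = 0\<close> also says that the positive
  frequencies \<open>m > 0\<close> are orthogonal to \<open>cnj f\<close>.\<close>

lemma circle_mean_shifted_coeff:
  assumes f: "f holomorphic_on unit_disc" and F: "f has_fps_expansion F" and r: "0 < r" "r < 1"
  shows "((\<lambda>t. f (of_real r * cis t) * (of_real r * cis t) ^ m * cis (- t) ^ n) has_integral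
           of_real (2 * pi * r ^ n) * (if n < m then 0 else fps_nth F (n - m))) {0..2*pi}"
proof -
  have "(\<lambda>z. z ^ m * f z) has_fps_expansion fps_X ^ m * F"
    by (intro fps_expansion_intros F)
  moreover have "(\<lambda>z. z ^ m * f z) holomorphic_on unit_disc"
    by (intro holomorphic_intros f)
  ultimately show ?thesis
    using circle_mean_coeff[of "\<lambda>z. z ^ m * f z" "fps_X ^ m * F" r n] r
    by (simp add: fps_X_power_mult_nth mult.commute[of "f _"] cong: if_cong)
qed

text \<open>Circle means are available for radii below \<open>1\<close> only; this carries the resulting estimates to
  radius \<open>1\<close>.\<close>

lemma cmod_polynomial_le_radial:
  fixes p :: "nat \<Rightarrow> complex"
  assumes "\<And>r. \<lbrakk>0 < r; r < 1\<rbrakk> \<Longrightarrow> cmod (\<Sum>j\<le>N. p j * of_real r ^ e j) \<le> M"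
  shows "cmod (\<Sum>j\<le>N. p j) \<le> M"
proof -
  have "((\<lambda>r. cmod (\<Sum>j\<le>N. p j * of_real r ^ e j)) \<longlongrightarrow> cmod (\<Sum>j\<le>N. p j * of_real 1 ^ e j)) (at_left (1::real))"
    by (intro tendsto_intros)
  hence "cmod (\<Sum>j\<le>N. p j * of_real 1 ^ e j) \<le> M"
  proof (rule tendsto_upperbound)
    show "\<forall>\<^sub>F r in at_left (1::real). cmod (\<Sum>j\<le>N. p j * of_real r ^ e j) \<le> M"
      using eventually_at_left_real[OF zero_less_one] by eventually_elim (use assms in auto)
  qed auto
  thus ?thesis by simp
qed

section \<open>Fejer sums of bounded functions\<close>

text \<open>Parseval's identity for a geometric sum.\<close>

lemma Fejer_kernel_square_mean:
  assumes r: "0 < r" "r < 1" and x: "cmod x = 1"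
  shows "((\<lambda>t. (cmod (\<Sum>i\<le>N. x ^ i * (of_real r * cis t) ^ i))\<^sup>2) has_integral
           2 * pi * (\<Sum>i\<le>N. r ^ (2 * i))) {0..2*pi}"
proof -
  have one: "((\<lambda>t. (of_real r * cis t) ^ i * cis (- t) ^ k) has_integral
      (if i = k then of_real (2 * pi * r ^ k) else 0)) {0..2*pi}" for i k
  proof -
    have "(\<lambda>_::complex. 1::complex) has_fps_expansion 1" by simp
    from circle_mean_shifted_coeff[OF holomorphic_on_const this r, of i k]
    show ?thesis by (auto split: if_splits)
  qed
  have "((\<lambda>t. \<Sum>i\<le>N. \<Sum>k\<le>N. (x ^ i * cnj x ^ k * of_real (r ^ k)) * ((of_real r * cis t) ^ i * cis (- t) ^ k))
     has_integral (\<Sum>i\<le>N. \<Sum>k\<le>N. (x ^ i * cnj x ^ k * of_real (r ^ k)) * (if i = k then of_real (2 * pi * r ^ k) else 0))) {0..2*pi}"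
    by (intro has_integral_sum has_integral_mult_right one) auto
  also have "(\<lambda>t. \<Sum>i\<le>N. \<Sum>k\<le>N. (x ^ i * cnj x ^ k * of_real (r ^ k)) * ((of_real r * cis t) ^ i * cis (- t) ^ k)) =
      (\<lambda>t. of_real ((cmod (\<Sum>i\<le>N. x ^ i * (of_real r * cis t) ^ i))\<^sup>2))"
  proof
    fix t
    have "of_real ((cmod (\<Sum>i\<le>N. x ^ i * (of_real r * cis t) ^ i))\<^sup>2) =
       (\<Sum>i\<le>N. x ^ i * (of_real r * cis t) ^ i) * (\<Sum>k\<le>N. cnj (x ^ k * (of_real r * cis t) ^ k))"
      by (simp only: complex_norm_square cnj_sum)
    also have "\<dots> = (\<Sum>i\<le>N. \<Sum>k\<le>N. (x ^ i * cnj x ^ k * of_real (r ^ k)) * ((of_real r * cis t) ^ i * cis (- t) ^ k))"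
      by (simp add: sum_product cis_cnj power_mult_distrib mult_ac)
    finally show "(\<Sum>i\<le>N. \<Sum>k\<le>N. (x ^ i * cnj x ^ k * of_real (r ^ k)) * ((of_real r * cis t) ^ i * cis (- t) ^ k)) =
      of_real ((cmod (\<Sum>i\<le>N. x ^ i * (of_real r * cis t) ^ i))\<^sup>2)" ..
  qed
  also have "(\<Sum>i\<le>N. \<Sum>k\<le>N. (x ^ i * cnj x ^ k * of_real (r ^ k)) * (if i = k then of_real (2 * pi * r ^ k) else 0)) =
     of_real (2 * pi * (\<Sum>i\<le>N. r ^ (2 * i)))"
  proof -
    have diag: "(\<Sum>k\<le>N. (x ^ i * cnj x ^ k * of_real (r ^ k)) * (if i = k then of_real (2 * pi * r ^ k) else 0)) =
        (of_real (2 * pi * r ^ (2 * i)) :: complex)" if "i \<le> N" for i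
    proof -
      have "x ^ i * cnj x ^ i = 1"
        using x by (simp flip: power_mult_distrib complex_norm_square)
      hence "(x ^ i * cnj x ^ i * of_real (r ^ i)) * of_real (2 * pi * r ^ i) =
          (of_real (r ^ i * (2 * pi * r ^ i)) :: complex)"
        by (simp only: of_real_mult mult_1_left)
      also have "r ^ i * (2 * pi * r ^ i) = 2 * pi * r ^ (2 * i)"
        by (simp add: mult_2[of i] power_add)
      finally have "(x ^ i * cnj x ^ i * of_real (r ^ i)) * of_real (2 * pi * r ^ i) =
          (of_real (2 * pi * r ^ (2 * i)) :: complex)" .
      moreover have "(\<Sum>k\<le>N. (x ^ i * cnj x ^ k * of_real (r ^ k)) * (if i = k then of_real (2 * pi * r ^ k) else 0)) =
          (\<Sum>k\<le>N. if k = i then (x ^ i * cnj x ^ i * of_real (r ^ i)) * of_real (2 * pi * r ^ i) else 0)"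
        by (rule sum.cong) auto
      ultimately show ?thesis using that by (simp only: sum.delta finite_atMost atMost_iff if_True)
    qed
    show ?thesis
      by (simp only: sum_distrib_left of_real_sum) (intro sum.cong refl diag, simp)
  qed
  finally have "((\<lambda>t. of_real ((cmod (\<Sum>i\<le>N. x ^ i * (of_real r * cis t) ^ i))\<^sup>2)::complex) has_integral
           of_real (2 * pi * (\<Sum>i\<le>N. r ^ (2 * i)))) {0..2*pi}" .
  from has_integral_Re[OF this] show ?thesis by (simp del: of_real_power of_real_mult)
qed

text \<open>The sum is the coefficient of \<open>z ^ N\<close> in \<open>w(z) S(z)\<^sup>2\<close>, where
  \<open>S(z) = (\<Sum>i\<le>N. (x z) ^ i)\<close>: modulo \<open>z ^ (N + 1)\<close> the square agrees with
  \<open>1 / (1 - x z)\<^sup>2 = (\<Sum>j. (j + 1) (x z) ^ j)\<close>. The gain of using a square is that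
  \<open>\<bar>w S\<^sup>2\<bar> \<le> \<bar>S\<bar>\<^sup>2\<close>, and the mean of \<open>\<bar>S\<bar>\<^sup>2\<close> is at most the number \<open>N + 1\<close> of its terms.\<close>

lemma Fejer_bound:
  assumes w: "w holomorphic_on unit_disc" and W: "w has_fps_expansion W"
    and le: "\<And>z. z \<in> unit_disc \<Longrightarrow> cmod (w z) \<le> 1" and x: "cmod x = 1"
  shows "cmod (\<Sum>j\<le>N. of_nat (Suc j) * x ^ j * fps_nth W (N - j)) \<le> real N + 1"
proof -
  define K where "K = (\<Sum>j\<le>N. of_nat (Suc j) * x ^ j * fps_nth W (N - j))"
  have "r ^ N * cmod K \<le> real N + 1" if r: "0 < r" "r < 1" for r
  proof -
    define S where "S = (\<lambda>t. \<Sum>i\<le>N. x ^ i * (of_real r * cis t) ^ i)"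
    define I where "I = (\<lambda>t. w (of_real r * cis t) * S t ^ 2 * cis (- t) ^ N)"
    have "((\<lambda>t. \<Sum>i\<le>N. \<Sum>k\<le>N. x ^ (i + k) * (w (of_real r * cis t) * (of_real r * cis t) ^ (i + k) * cis (- t) ^ N))
        has_integral (\<Sum>i\<le>N. \<Sum>k\<le>N. x ^ (i + k) * (of_real (2 * pi * r ^ N) * (if N < i + k then 0 else fps_nth W (N - (i + k)))))) {0..2*pi}"
      by (intro has_integral_sum has_integral_mult_right circle_mean_shifted_coeff w W r) auto
    also have "(\<lambda>t. \<Sum>i\<le>N. \<Sum>k\<le>N. x ^ (i + k) * (w (of_real r * cis t) * (of_real r * cis t) ^ (i + k) * cis (- t) ^ N)) = I"
      by (simp add: I_def S_def power2_eq_square sum_product power_add sum_distrib_left sum_distrib_right mult_ac)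
    also have "(\<Sum>i\<le>N. \<Sum>k\<le>N. x ^ (i + k) * (of_real (2 * pi * r ^ N) * (if N < i + k then 0 else fps_nth W (N - (i + k)))))
        = of_real (2 * pi * r ^ N) * (\<Sum>(i, k) \<in> {..N} \<times> {..N}. if N < i + k then 0 else x ^ (i + k) * fps_nth W (N - (i + k)))"
      by (simp add: sum.cartesian_product[symmetric] sum_distrib_left mult_ac if_distrib[of "\<lambda>u. _ * u"] cong: if_cong)
    also have "(\<Sum>(i, k) \<in> {..N} \<times> {..N}. if N < i + k then 0 else x ^ (i + k) * fps_nth W (N - (i + k)))
        = (\<Sum>(i, k) \<in> {(i, k). i + k \<le> N}. x ^ (i + k) * fps_nth W (N - (i + k)))"
      by (rule sum.mono_neutral_cong_right) (auto split: if_splits)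
    also have "\<dots> = (\<Sum>j\<le>N. \<Sum>i\<le>j. x ^ (i + (j - i)) * fps_nth W (N - (i + (j - i))))"
      by (rule sum.triangle_reindex_eq)
    also have "\<dots> = K" by (simp add: K_def mult_ac)
    finally have I: "(I has_integral of_real (2 * pi * r ^ N) * K) {0..2*pi}" .
    have Iint: "((\<lambda>t. (cmod (S t))\<^sup>2) has_integral 2 * pi * (\<Sum>i\<le>N. r ^ (2 * i))) {0..2*pi}"
      unfolding S_def by (rule Fejer_kernel_square_mean[OF r x])
    have "cmod (integral {0..2*pi} I) \<le> integral {0..2*pi} (\<lambda>t. (cmod (S t))\<^sup>2)"
    proof (rule integral_norm_bound_integral)
      fix t
      have "cmod (w (of_real r * cis t)) \<le> 1" using r by (intro le) (simp add: norm_mult)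
      thus "cmod (I t) \<le> (cmod (S t))\<^sup>2"
        by (simp add: I_def norm_mult norm_power mult_left_le_one_le)
    qed (use I Iint in auto)
    hence "2 * pi * (r ^ N * cmod K) \<le> 2 * pi * (\<Sum>i\<le>N. r ^ (2 * i))"
      using r by (simp add: integral_unique[OF I] integral_unique[OF Iint] norm_mult norm_power)
    hence "r ^ N * cmod K \<le> (\<Sum>i\<le>N. r ^ (2 * i))" by simp
    also have "\<dots> \<le> (\<Sum>i\<le>N. 1)" using r by (intro sum_mono power_le_one) auto
    finally show ?thesis by simp
  qed
  hence "cmod K \<le> real N + 1"
    using cmod_polynomial_le_radial[where N = 0 and p = "\<lambda>_. K" and e = "\<lambda>_. N" and M = "real N + 1"]
    by (simp add: norm_mult norm_power mult.commute)
  thus ?thesis by (simp only: K_def)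
qed

section \<open>Functions with real part above one half\<close>

text \<open>The density \<open>D = 2 Re q - 1\<close> on the circle of radius \<open>r\<close> is nonnegative, has mean \<open>1\<close>, and its
  Fourier coefficients of index \<open>j \<ge> 0\<close> are \<open>r ^ j\<close> times the Taylor coefficients of \<open>q\<close>. So the sum
  is, as \<open>r\<close> tends to \<open>1\<close>, a limit of averages of the values of the polynomial \<open>p\<close> on the unit
  circle. This replaces the Herglotz representation of \<open>q\<close> as an average of the functions
  \<open>1 / (1 - x z)\<close> with \<open>\<bar>x\<bar> = 1\<close>.\<close>

lemma half_plane_coeff_functional_bound:
  assumes q: "q holomorphic_on unit_disc" and Q: "q has_fps_expansion Q" and q0: "q 0 = 1"
    and half: "\<And>z. z \<in> unit_disc \<Longrightarrow> Re (q z) > 1/2"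
    and p: "\<And>x. cmod x = 1 \<Longrightarrow> cmod (\<Sum>j\<le>N. p j * x ^ j) \<le> M"
  shows "cmod (\<Sum>j\<le>N. p j * fps_nth Q j) \<le> M"
proof (rule cmod_polynomial_le_radial)
  fix r :: real assume r: "0 < r" "r < 1"
  have Q0: "fps_nth Q 0 = 1" using has_fps_expansion_imp_0_eq_fps_nth_0[OF Q] q0 by simp
  define D where "D = (\<lambda>t. 2 * Re (q (of_real r * cis t)) - 1)"
  have one: "((\<lambda>t. cis (- t) ^ j) has_integral (if j = 0 then of_real (2 * pi) else 0)) {0..2*pi}" for j
    using circle_mean_coeff[OF holomorphic_on_const has_fps_expansion_1 r, of j] by auto
  have mean: "((\<lambda>t. of_real (D t) * cis (- t) ^ j) has_integral of_real (2 * pi * r ^ j) * fps_nth Q j) {0..2*pi}" for j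
  proof -
    \<comment> \<open>conjugating the mean of \<open>q z ^ j\<close>, which is \<open>q 0 = 1\<close> for \<open>j = 0\<close> and vanishes otherwise\<close>
    have qm: "((\<lambda>t. cnj (q (of_real r * cis t)) * cis (- t) ^ j) has_integral (if j = 0 then of_real (2 * pi) else 0)) {0..2*pi}"
    proof -
      have "((\<lambda>t. q (of_real r * cis t) * (of_real r * cis t) ^ j) has_integral (if j = 0 then of_real (2 * pi) else 0)) {0..2*pi}"
        using circle_mean_shifted_coeff[OF q Q r, of j 0] Q0 by (auto split: if_splits)
      from has_integral_mult_right[OF has_integral_cnj[THEN iffD2, OF this], of "of_real (1 / r ^ j)"] r
      show ?thesis by (auto simp: o_def cis_cnj power_mult_distrib split: if_splits)
    qed
    have "((\<lambda>t. q (of_real r * cis t) * cis (- t) ^ j + cnj (q (of_real r * cis t)) * cis (- t) ^ j - cis (- t) ^ j)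
       has_integral of_real (2 * pi * r ^ j) * fps_nth Q j + (if j = 0 then of_real (2 * pi) else 0) - (if j = 0 then of_real (2 * pi) else 0)) {0..2*pi}"
      by (intro has_integral_diff has_integral_add qm one circle_mean_coeff q Q r)
    moreover have "q (of_real r * cis t) * cis (- t) ^ j + cnj (q (of_real r * cis t)) * cis (- t) ^ j - cis (- t) ^ j
       = of_real (D t) * cis (- t) ^ j" for t
    proof -
      have D: "of_real (D t) = q (of_real r * cis t) + cnj (q (of_real r * cis t)) - 1"
        unfolding D_def complex_add_cnj by simp
      show ?thesis unfolding D by (simp add: algebra_simps)
    qed
    ultimately show ?thesis by simp
  qed
  have Dint: "(D has_integral 2 * pi) {0..2*pi}"
    using has_integral_Re[OF mean[of 0]] Q0 by simp
  define J where "J = (\<lambda>t. \<Sum>j\<le>N. p j * (of_real (D t) * cis (- t) ^ j))"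
  have J: "(J has_integral (\<Sum>j\<le>N. p j * (of_real (2 * pi * r ^ j) * fps_nth Q j))) {0..2*pi}"
    unfolding J_def by (intro has_integral_sum has_integral_mult_right mean) auto
  have MD: "((\<lambda>t. M * D t) has_integral M * (2 * pi)) {0..2*pi}"
    by (intro has_integral_mult_right Dint)
  have "cmod (integral {0..2*pi} J) \<le> integral {0..2*pi} (\<lambda>t. M * D t)"
  proof (rule integral_norm_bound_integral)
    fix t
    have "Re (q (of_real r * cis t)) > 1/2" using r by (intro half) (simp add: norm_mult)
    hence D0: "D t \<ge> 0" by (simp add: D_def)
    have "J t = of_real (D t) * (\<Sum>j\<le>N. p j * cis (- t) ^ j)"
      by (simp add: J_def sum_distrib_left mult_ac)
    hence "cmod (J t) = D t * cmod (\<Sum>j\<le>N. p j * cis (- t) ^ j)"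
      using D0 by (simp add: norm_mult)
    also have "\<dots> \<le> D t * M" using D0 by (intro mult_left_mono p) auto
    finally show "cmod (J t) \<le> M * D t" by (simp add: mult.commute)
  qed (use J MD in auto)
  moreover have "(\<Sum>j\<le>N. p j * (of_real (2 * pi * r ^ j) * fps_nth Q j)) =
      of_real (2 * pi) * (\<Sum>j\<le>N. p j * fps_nth Q j * of_real r ^ j)"
    by (simp add: sum_distrib_left mult_ac)
  ultimately show "cmod (\<Sum>j\<le>N. p j * fps_nth Q j * of_real r ^ j) \<le> M"
    by (simp add: integral_unique[OF J] integral_unique[OF Dint] norm_mult)
qed

section \<open>Uniqueness of the decomposition\<close>

text \<open>The image would otherwise be an open subset of the imaginary axis.\<close>

lemma holomorphic_imaginary_eq_const:
  assumes u: "u holomorphic_on unit_disc" and Re: "\<And>z. z \<in> unit_disc \<Longrightarrow> Re (u z) = 0"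
    and z: "z \<in> unit_disc"
  shows "u z = u 0"
proof -
  have "u constant_on unit_disc"
  proof (rule ccontr)
    assume nc: "\<not> u constant_on unit_disc"
    have "open (u ` unit_disc)"
      by (rule open_mapping_thm[OF u _ _ _ _ nc]) auto
    hence "u ` unit_disc \<subseteq> interior {w. Re w = 0}"
      by (intro interior_maximal) (use Re in auto)
    moreover have "interior {w. Re w = 0} = {}"
      using interior_hyperplane[of "1::complex" 0] by (simp add: inner_complex_def)
    ultimately show False by auto
  qed
  thus ?thesis using z by (auto simp: constant_on_def)
qed

text \<open>Put \<open>H = h - h'\<close> and \<open>G = g' - g\<close>, so that \<open>H = cnj G\<close>. So \<open>H - G\<close> is
  imaginary, hence constantly \<open>0\<close>; then \<open>H\<close> is real, and \<open>\<i> * H\<close> vanishes for the same reason.\<close>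

lemma harmonic_decomp_unique:
  assumes 1: "harmonic_decomp f h g" and 2: "harmonic_decomp f h' g'" and z: "z \<in> unit_disc"
  shows "h z = h' z" "g z = g' z"
proof -
  have hol: "h holomorphic_on unit_disc" "g holomorphic_on unit_disc"
    "h' holomorphic_on unit_disc" "g' holomorphic_on unit_disc"
    and at0: "h 0 = 0" "g 0 = 0" "h' 0 = 0" "g' 0 = 0"
    using 1 2 by (auto simp: harmonic_decomp_def)
  have conj: "h u - h' u = cnj (g' u - g u)" if "u \<in> unit_disc" for u
  proof -
    have "h u + cnj (g u) = h' u + cnj (g' u)" using 1 2 that by (auto simp: harmonic_decomp_def)
    thus ?thesis by (simp add: algebra_simps)
  qed
  have eq: "(h u - h' u) - (g' u - g u) = 0" if "u \<in> unit_disc" for u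
  proof -
    have "(h u - h' u) - (g' u - g u) = (h 0 - h' 0) - (g' 0 - g 0)"
    proof (rule holomorphic_imaginary_eq_const[OF _ _ that])
      show "(\<lambda>u. (h u - h' u) - (g' u - g u)) holomorphic_on unit_disc"
        by (intro holomorphic_intros hol)
      show "Re ((h u - h' u) - (g' u - g u)) = 0" if "u \<in> unit_disc" for u
        unfolding conj[OF that] by simp
    qed
    thus ?thesis by (simp add: at0)
  qed
  have "\<i> * (h z - h' z) = \<i> * (h 0 - h' 0)"
  proof (rule holomorphic_imaginary_eq_const[OF _ _ z])
    show "(\<lambda>u. \<i> * (h u - h' u)) holomorphic_on unit_disc"
      by (intro holomorphic_intros hol)
    show "Re (\<i> * (h u - h' u)) = 0" if "u \<in> unit_disc" for u
    proof -
      have "h u - h' u = cnj (h u - h' u)" using conj[OF that] eq[OF that] by simp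
      hence "Im (h u - h' u) = Im (cnj (h u - h' u))" by (rule arg_cong)
      thus ?thesis by simp
    qed
  qed
  thus "h z = h' z" by (simp add: at0)
  thus "g z = g' z" using eq[OF z] by simp
qed

section \<open>The coefficient bound\<close>

lemma has_fps_expansion_if_sums_on_disc:
  assumes "\<And>z. z \<in> unit_disc \<Longrightarrow> (\<lambda>n. fps_nth F n * z ^ n) sums (f z :: complex)"
  shows "f has_fps_expansion F"
proof -
  have "fps_conv_radius F \<ge> 1" unfolding fps_conv_radius_def
  proof (rule conv_radius_geI_ex)
    fix r :: real assume r: "0 < r" "ereal r < 1"
    hence "summable (\<lambda>n. fps_nth F n * of_real r ^ n)"
      using assms[of "of_real r"] by (auto simp: sums_iff)
    thus "\<exists>z. norm z = r \<and> summable (\<lambda>n. fps_nth F n * z ^ n)"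
      using r by (intro exI[of _ "of_real r"]) auto
  qed
  hence "0 < fps_conv_radius F" by (rule less_le_trans[rotated]) simp
  moreover have "eventually (\<lambda>z. eval_fps F z = f z) (nhds 0)"
  proof -
    have "eventually (\<lambda>z::complex. z \<in> unit_disc) (nhds 0)"
      by (intro eventually_nhds_in_open) auto
    thus ?thesis
      by eventually_elim (use assms in \<open>auto simp: eval_fps_def sums_iff\<close>)
  qed
  ultimately show ?thesis by (simp add: has_fps_expansion_def)
qed

text \<open>Put \<open>h = z q\<close> and \<open>n = N + 1\<close>, and let \<open>W\<close> and \<open>Q\<close> be the Taylor series of \<open>w\<close> and \<open>q\<close>.
  Comparing coefficients in \<open>g' = w (z q)'\<close> yields
  \<open>n b\<^sub>n = (\<Sum>j\<le>N. (j + 1) W\<^sub>N\<^sub>-\<^sub>j Q\<^sub>j)\<close>. As \<open>Re q > 1/2\<close>, this is bounded by the supremum on the unit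
  circle of the polynomial with coefficients \<open>(j + 1) W\<^sub>N\<^sub>-\<^sub>j\<close>, which the Fejer bound estimates by
  \<open>N + 1 = n\<close>.\<close>

lemma convex_dilatation_coeff_bound:
  assumes h: "h holomorphic_on unit_disc" "h 0 = 0" "deriv h 0 = 1"
    and nz: "\<And>z. z \<in> unit_disc \<Longrightarrow> deriv h z \<noteq> 0"
    and convex: "\<And>z. z \<in> unit_disc \<Longrightarrow> Re (1 + z * deriv (deriv h) z / deriv h z) > 0"
    and w: "w holomorphic_on unit_disc" "\<And>z. z \<in> unit_disc \<Longrightarrow> cmod (w z) \<le> 1"
    and g': "\<And>z. z \<in> unit_disc \<Longrightarrow> deriv g z = w z * deriv h z"
    and G: "g has_fps_expansion G" and "n \<ge> 1"
  shows "cmod (fps_nth G n) \<le> 1"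
proof -
  obtain q where q: "q holomorphic_on unit_disc" "\<And>z. cmod z < 1 \<Longrightarrow> h z = z * q z" "deriv h 0 = q 0"
    using Schwarz3[OF h(1,2)] by blast
  define Q where "Q = fps_expansion q 0"
  define W where "W = fps_expansion w 0"
  have Q: "q has_fps_expansion Q" unfolding Q_def
    using q(1) by (intro has_fps_expansion_fps_expansion[of unit_disc]) auto
  have W: "w has_fps_expansion W" unfolding W_def
    using w(1) by (intro has_fps_expansion_fps_expansion[of unit_disc]) auto
  have disc: "eventually (\<lambda>z::complex. z \<in> unit_disc) (nhds 0)"
    by (intro eventually_nhds_in_open) auto
  have "h has_fps_expansion fps_X * Q"
  proof (subst has_fps_expansion_cong[OF _ refl])
    show "eventually (\<lambda>z. h z = z * q z) (nhds 0)" using disc by eventually_elim (use q in auto)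
    show "(\<lambda>z. z * q z) has_fps_expansion fps_X * Q" by (intro fps_expansion_intros Q)
  qed
  hence h': "deriv h has_fps_expansion fps_deriv (fps_X * Q)" by (rule has_fps_expansion_deriv)
  have "deriv g has_fps_expansion W * fps_deriv (fps_X * Q)"
  proof (subst has_fps_expansion_cong[OF _ refl])
    show "eventually (\<lambda>z. deriv g z = w z * deriv h z) (nhds 0)" using disc by eventually_elim (use g' in auto)
    show "(\<lambda>z. w z * deriv h z) has_fps_expansion W * fps_deriv (fps_X * Q)"
      by (intro fps_expansion_intros W h')
  qed
  hence eq: "fps_deriv G = W * fps_deriv (fps_X * Q)"
    using has_fps_expansion_deriv[OF G] fps_expansion_unique_complex by blast
  obtain N where N: "n = Suc N" using \<open>n \<ge> 1\<close> by (cases n) auto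
  have "of_nat n * fps_nth G n = fps_nth (fps_deriv G) N"
    using N by simp
  also have "\<dots> = fps_nth (fps_deriv (fps_X * Q) * W) N"
    unfolding eq by (simp only: mult.commute)
  also have "\<dots> = (\<Sum>j\<le>N. (of_nat (Suc j) * fps_nth W (N - j)) * fps_nth Q j)"
  proof -
    have "fps_nth (fps_deriv (fps_X * Q)) j = of_nat (Suc j) * fps_nth Q j" for j
      by (simp only: fps_deriv_nth fps_X_mult_nth) simp
    thus ?thesis unfolding fps_mult_nth atLeast0AtMost by (simp only: mult_ac)
  qed
  finally have coeff: "of_nat n * fps_nth G n = (\<Sum>j\<le>N. (of_nat (Suc j) * fps_nth W (N - j)) * fps_nth Q j)" .
  have "cmod (of_nat n * fps_nth G n) \<le> real N + 1"
    unfolding coeff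
  proof (rule half_plane_coeff_functional_bound[OF q(1) Q])
    show "q 0 = 1" using q h by simp
    show "Re (q z) > 1/2" if "z \<in> unit_disc" for z
      by (rule convex_imp_half_plane[OF h(1) q(1) _ _ nz convex that]) (use q h in auto)
    show "cmod (\<Sum>j\<le>N. (of_nat (Suc j) * fps_nth W (N - j)) * x ^ j) \<le> real N + 1" if "cmod x = 1" for x
      using Fejer_bound[OF w(1) W w(2) that, of N] by (simp add: mult_ac)
  qed
  also have "real N + 1 = real n" using N by simp
  finally have "real n * cmod (fps_nth G n) \<le> real n * 1" by (simp only: norm_mult norm_of_nat mult_1_right)
  thus ?thesis using N by (simp only: mult_le_cancel_left_pos of_nat_0_less_iff zero_less_Suc)
qed

text \<open>Convexity and the dilatation condition are known for some decomposition of \<open>f\<close>, the coefficients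
  belong to a given one; uniqueness identifies the two.\<close>

lemma class_F0_coeff_bound:
  assumes f: "f \<in> class_F0" and dec: "harmonic_decomp f h g"
    and ps: "power_series_coeffs h g a b" and n: "n \<ge> 1"
  shows "cmod (b n) \<le> 1"
proof -
  obtain h1 g1 \<phi> where dec1: "harmonic_decomp f h1 g1"
    and nz: "\<And>z. z \<in> unit_disc \<Longrightarrow> deriv h1 z \<noteq> 0"
    and convex: "\<And>z. z \<in> unit_disc \<Longrightarrow> Re (1 + z * deriv (deriv h1) z / deriv h1 z) > 0"
    and \<phi>: "\<phi> \<in> Aut_disc" and dil: "\<And>z. z \<in> unit_disc \<Longrightarrow> deriv g1 z / deriv h1 z = \<phi> z"
    using f unfolding class_F0_def by blast
  have hol: "\<phi> holomorphic_on unit_disc" "\<And>z. z \<in> unit_disc \<Longrightarrow> cmod (\<phi> z) \<le> 1"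
    using \<phi> by (auto simp: Aut_disc_def Moebius_function_holomorphic
        intro!: less_imp_le[OF Moebius_function_norm_lt_1])
  define G where "G = Abs_fps (\<lambda>n. if n = 0 then 0 else b n)"
  have "g1 has_fps_expansion G"
  proof (rule has_fps_expansion_if_sums_on_disc)
    fix z :: complex assume z: "z \<in> unit_disc"
    have "(\<lambda>n. b (n + 1) * z ^ (n + 1)) sums g z"
      using ps z by (simp add: power_series_coeffs_def)
    hence "(\<lambda>n. fps_nth G (Suc n) * z ^ Suc n) sums (g1 z)"
      using harmonic_decomp_unique(2)[OF dec dec1 z] by (simp add: G_def)
    from sums_Suc[OF this] show "(\<lambda>n. fps_nth G n * z ^ n) sums g1 z" by (simp add: G_def)
  qed
  moreover have "deriv g1 z = \<phi> z * deriv h1 z" if "z \<in> unit_disc" for z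
    using dil[OF that] nz[OF that] by (simp add: field_simps)
  moreover have "h1 holomorphic_on unit_disc" "h1 0 = 0" "deriv h1 0 = 1"
    using dec1 by (auto simp: harmonic_decomp_def)
  ultimately have "cmod (fps_nth G n) \<le> 1"
    using convex_dilatation_coeff_bound[OF _ _ _ nz convex hol] n by blast
  thus ?thesis using n by (simp add: G_def)
qed

section \<open>An extremal family\<close>

definition half_plane_map :: "complex \<Rightarrow> complex"
  where "half_plane_map z = z / (1 - z)"

text \<open>The antiderivative of \<open>\<omega> h'\<close> that vanishes at \<open>0\<close>, for \<open>h(z) = z / (1 - z)\<close> and
  \<open>\<omega>(z) = (z + r) / (1 + r z)\<close>. The identity \<open>\<omega>(z) = 1 - (1 - r) (1 - z) / (1 + r z)\<close> splits the
  integrand into \<open>1 / (1 - z)\<^sup>2 - (1 - r) / ((1 + r z) (1 - z))\<close>, and partial fractions give the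
  logarithms.\<close>

definition half_plane_partner :: "real \<Rightarrow> complex \<Rightarrow> complex"
  where "half_plane_partner r z =
    z / (1 - z) - of_real ((1 - r) / (1 + r)) * (Ln (1 + of_real r * z) - Ln (1 - z))"

definition half_plane_partner_coeff :: "real \<Rightarrow> nat \<Rightarrow> real"
  where "half_plane_partner_coeff r n = 1 - (1 - r) * (1 - (- r) ^ n) / ((1 + r) * real n)"

lemma one_plus_real_mult_slit_plane:
  assumes "z \<in> unit_disc" "\<bar>r\<bar> \<le> 1"
  shows "1 + of_real r * z \<noteq> 0" "1 + of_real r * z \<notin> \<real>\<^sub>\<le>\<^sub>0"
proof -
  have "cmod (of_real r * z) < 1"
    using assms mult_right_mono[of "\<bar>r\<bar>" 1 "cmod z"] by (simp add: norm_mult)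
  hence "\<bar>Re (of_real r * z)\<bar> < 1" using abs_Re_le_cmod order.strict_trans1 by blast
  hence "Re (1 + of_real r * z) > 0" by simp
  thus "1 + of_real r * z \<noteq> 0" "1 + of_real r * z \<notin> \<real>\<^sub>\<le>\<^sub>0"
    by (auto simp: complex_nonpos_Reals_iff complex_eq_iff)
qed

lemma half_plane_map_derivs:
  assumes "z \<in> unit_disc"
  shows "(half_plane_map has_field_derivative 1 / (1 - z)\<^sup>2) (at z)"
    and "deriv half_plane_map z = 1 / (1 - z)\<^sup>2"
    and "deriv (deriv half_plane_map) z = 2 / (1 - z) ^ 3"
proof -
  have D: "(half_plane_map has_field_derivative 1 / (1 - z)\<^sup>2) (at z)" if "z \<in> unit_disc" for z
  proof -
    have "1 - z \<noteq> 0" using that by auto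
    thus ?thesis unfolding half_plane_map_def
      by (auto intro!: derivative_eq_intros simp: field_simps power2_eq_square)
  qed
  show "(half_plane_map has_field_derivative 1 / (1 - z)\<^sup>2) (at z)" by (rule D[OF assms])
  show "deriv half_plane_map z = 1 / (1 - z)\<^sup>2" by (rule DERIV_imp_deriv[OF D[OF assms]])
  have nz: "1 - z \<noteq> 0" using assms by auto
  hence "((\<lambda>z. 1 / (1 - z)\<^sup>2) has_field_derivative 2 / (1 - z) ^ 3) (at z)"
    by (auto intro!: derivative_eq_intros simp: divide_simps) (auto simp: power_numeral_reduce algebra_simps)
  hence "(deriv half_plane_map has_field_derivative 2 / (1 - z) ^ 3) (at z)"
    by (rule has_field_derivative_transform_within_open[of _ _ _ unit_disc])
      (use assms in \<open>auto simp: DERIV_imp_deriv[OF D]\<close>)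
  thus "deriv (deriv half_plane_map) z = 2 / (1 - z) ^ 3" by (rule DERIV_imp_deriv)
qed

lemma half_plane_partner_deriv:
  assumes z: "z \<in> unit_disc" and r: "0 \<le> r" "r < 1"
  shows "(half_plane_partner r has_field_derivative
           Moebius_function 0 (- of_real r) z / (1 - z)\<^sup>2) (at z)"
proof -
  have nz: "1 - z \<noteq> 0" "1 - z \<notin> \<real>\<^sub>\<le>\<^sub>0" "1 + of_real r * z \<noteq> 0" "1 + of_real r * z \<notin> \<real>\<^sub>\<le>\<^sub>0"
    using one_plus_real_mult_slit_plane[OF z, of "-1"] one_plus_real_mult_slit_plane[OF z, of r] r by auto
  have "((\<lambda>z. z / (1 - z)) has_field_derivative 1 / (1 - z)\<^sup>2) (at z)"
    using half_plane_map_derivs(1)[OF z] by (simp add: half_plane_map_def[abs_def])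
  moreover have "((\<lambda>z. Ln (1 + of_real r * z)) has_field_derivative of_real r / (1 + of_real r * z)) (at z)"
    using nz by (auto intro!: derivative_eq_intros simp: field_simps)
  moreover have "((\<lambda>z. Ln (1 - z)) has_field_derivative - (1 / (1 - z))) (at z)"
    using nz by (auto intro!: derivative_eq_intros simp: field_simps)
  ultimately have "((\<lambda>z. z / (1 - z) - of_real ((1 - r) / (1 + r)) * (Ln (1 + of_real r * z) - Ln (1 - z)))
    has_field_derivative 1 / (1 - z)\<^sup>2 - of_real ((1 - r) / (1 + r)) *
      (of_real r / (1 + of_real r * z) - - (1 / (1 - z)))) (at z)"
    by (intro DERIV_diff DERIV_cmult)
  hence "(half_plane_partner r has_field_derivative
     1 / (1 - z)\<^sup>2 - of_real ((1 - r) / (1 + r)) * (of_real r / (1 + of_real r * z) + 1 / (1 - z))) (at z)"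
    by (simp only: half_plane_partner_def[abs_def] minus_minus diff_minus_eq_add)
  also have "of_real r / (1 + of_real r * z) + 1 / (1 - z) = of_real (1 + r) / ((1 + of_real r * z) * (1 - z))"
    using nz by (simp add: divide_simps) (simp add: algebra_simps)
  also have "of_real ((1 - r) / (1 + r)) * (of_real (1 + r) / ((1 + of_real r * z) * (1 - z)))
     = of_real (1 - r) / ((1 + of_real r * z) * (1 - z))"
  proof -
    have "complex_of_real (1 + r) \<noteq> 0" using r by (simp only: of_real_eq_0_iff)
    thus ?thesis unfolding of_real_divide by simp
  qed
  also have "1 / (1 - z)\<^sup>2 - of_real (1 - r) / ((1 + of_real r * z) * (1 - z))
     = Moebius_function 0 (- of_real r) z / (1 - z)\<^sup>2"
    using nz by (simp add: Moebius_function_simple divide_simps power2_eq_square) (simp add: algebra_simps)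
  finally show ?thesis .
qed

lemma half_plane_partner_sums:
  assumes z: "z \<in> unit_disc" and r: "0 \<le> r" "r < 1"
  shows "(\<lambda>n. of_real (half_plane_partner_coeff r (n + 1)) * z ^ (n + 1)) sums half_plane_partner r z"
proof -
  have rz: "cmod (of_real r * z) < 1"
    using z r mult_right_mono[of r 1 "cmod z"] by (simp add: norm_mult)
  have "(\<lambda>n. z * z ^ n) sums (z * (1 / (1 - z)))"
    using z by (intro sums_mult geometric_sums) auto
  hence 1: "(\<lambda>n. z ^ Suc n) sums (z / (1 - z))" by simp
  have "(\<lambda>n. (-1) ^ Suc n / of_nat n * (of_real r * z) ^ n) sums Ln (1 + of_real r * z)"
    using rz by (rule Ln_series)
  hence 2: "(\<lambda>n. (-1) ^ Suc (Suc n) / of_nat (Suc n) * (of_real r * z) ^ Suc n) sums Ln (1 + of_real r * z)"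
    by (subst sums_Suc_iff) simp
  have "(\<lambda>n. (-1) ^ Suc n / of_nat n * (- z) ^ n) sums Ln (1 + - z)"
    using z by (intro Ln_series) auto
  hence 3: "(\<lambda>n. (-1) ^ Suc (Suc n) / of_nat (Suc n) * (- z) ^ Suc n) sums Ln (1 - z)"
    by (subst sums_Suc_iff) simp
  have "(\<lambda>n. z ^ Suc n - of_real ((1 - r) / (1 + r)) *
      ((-1) ^ Suc (Suc n) / of_nat (Suc n) * (of_real r * z) ^ Suc n
        - (-1) ^ Suc (Suc n) / of_nat (Suc n) * (- z) ^ Suc n)) sums half_plane_partner r z"
    unfolding half_plane_partner_def by (intro sums_diff sums_mult 1 2 3)
  also have "(\<lambda>n. z ^ Suc n - of_real ((1 - r) / (1 + r)) *
      ((-1) ^ Suc (Suc n) / of_nat (Suc n) * (of_real r * z) ^ Suc n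
        - (-1) ^ Suc (Suc n) / of_nat (Suc n) * (- z) ^ Suc n)) =
      (\<lambda>n. of_real (half_plane_partner_coeff r (n + 1)) * z ^ (n + 1))"
  proof
    fix n
    \<comment> \<open>the alternating signs of the series of \<open>Ln (1 + u)\<close> merge with the powers at \<open>u = r z\<close> and \<open>u = - z\<close>\<close>
    have s: "(-1) ^ Suc (Suc n) * (of_real r * z) ^ Suc n = - (of_real ((- r) ^ Suc n) * z ^ Suc n)"
      "(-1) ^ Suc (Suc n) * (- z) ^ Suc n = - (z ^ Suc n)"
      using power_mult_distrib[of "-1" "of_real r * z" "Suc n"] power_mult_distrib[of "-1" "- z" "Suc n"]
      by (simp_all add: power_mult_distrib flip: of_real_power)
        (simp_all add: power_minus[of "of_real r"] power_minus[of z])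
    have "z ^ Suc n - of_real ((1 - r) / (1 + r)) *
      ((-1) ^ Suc (Suc n) / of_nat (Suc n) * (of_real r * z) ^ Suc n
        - (-1) ^ Suc (Suc n) / of_nat (Suc n) * (- z) ^ Suc n) =
      z ^ Suc n - of_real ((1 - r) / (1 + r)) *
      ((- (of_real ((- r) ^ Suc n) * z ^ Suc n) - (- (z ^ Suc n))) / of_nat (Suc n))"
      by (simp only: s[symmetric] diff_divide_distrib times_divide_eq_left)
    also have "\<dots> = of_real (1 - (1 - r) * (1 - (- r) ^ Suc n) / ((1 + r) * real (Suc n))) * z ^ Suc n"
    proof -
      have "1 - (1 - r) * (1 - (- r) ^ Suc n) / ((1 + r) * real (Suc n)) =
          1 - (1 - r) / (1 + r) * ((1 - (- r) ^ Suc n) / real (Suc n))"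
        by (simp only: times_divide_times_eq)
      hence R: "complex_of_real (1 - (1 - r) * (1 - (- r) ^ Suc n) / ((1 + r) * real (Suc n))) =
          1 - of_real ((1 - r) / (1 + r)) * ((1 - of_real ((- r) ^ Suc n)) / of_nat (Suc n))"
        by (simp only: of_real_diff of_real_mult of_real_1 of_real_divide[of "1 - (- r) ^ Suc n"] of_real_of_nat_eq)
      have alg: "A - c * ((- (p * A) - - A) / m) = (1 - c * ((1 - p) / m)) * A" for A c p m :: complex
        by (simp add: algebra_simps diff_divide_distrib)
      show ?thesis unfolding R by (rule alg)
    qed
    finally show "z ^ Suc n - of_real ((1 - r) / (1 + r)) *
      ((-1) ^ Suc (Suc n) / of_nat (Suc n) * (of_real r * z) ^ Suc n
        - (-1) ^ Suc (Suc n) / of_nat (Suc n) * (- z) ^ Suc n) =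
        of_real (half_plane_partner_coeff r (n + 1)) * z ^ (n + 1)"
      by (simp add: half_plane_partner_coeff_def)
  qed
  finally show ?thesis .
qed

text \<open>As \<open>r\<close> tends to \<open>1\<close> the dilatation tends to the constant \<open>1\<close>, and so does every coefficient.\<close>

lemma half_plane_partner_coeff_ge:
  assumes r: "0 \<le> r" "r < 1" and n: "n \<ge> 1"
  shows "r \<le> half_plane_partner_coeff r n"
proof -
  have "\<bar>(- r) ^ n\<bar> \<le> r"
    using power_decreasing[of 1 n r] r n by (simp add: power_abs)
  hence "1 - (- r) ^ n \<le> (1 + r) * 1" using abs_le_D2 by fastforce
  also have "\<dots> \<le> (1 + r) * real n" using r n by (intro mult_left_mono) auto
  finally have "(1 - (- r) ^ n) / ((1 + r) * real n) \<le> 1"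
    using r n by (subst divide_le_eq) auto
  hence "(1 - r) * ((1 - (- r) ^ n) / ((1 + r) * real n)) \<le> (1 - r) * 1"
    using r by (intro mult_left_mono) auto
  thus ?thesis by (simp add: half_plane_partner_coeff_def)
qed

text \<open>Convexity of \<open>h(z) = z / (1 - z)\<close> is explicit: \<open>1 + z h'' / h' = 2 / (1 - z) - 1\<close>, and \<open>1 / (1 - z)\<close>
  has real part above \<open>1/2\<close>.\<close>

lemma half_plane_example:
  assumes r: "0 \<le> r" "r < 1"
  defines "f \<equiv> \<lambda>z. half_plane_map z + cnj (half_plane_partner r z)"
  shows "f \<in> class_F0" "harmonic_decomp f half_plane_map (half_plane_partner r)"
    "power_series_coeffs half_plane_map (half_plane_partner r) (\<lambda>_. 1)
       (\<lambda>n. of_real (half_plane_partner_coeff r n))"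
proof -
  note dg = half_plane_partner_deriv[OF _ r]
  show dec: "harmonic_decomp f half_plane_map (half_plane_partner r)"
  proof -
    have "half_plane_map holomorphic_on unit_disc" "half_plane_partner r holomorphic_on unit_disc"
      unfolding holomorphic_on_open[OF open_ball] using half_plane_map_derivs(1) dg by blast+
    moreover have "deriv half_plane_map 0 = 1" by (subst half_plane_map_derivs(2)) auto
    ultimately show ?thesis
      by (auto simp: harmonic_decomp_def f_def half_plane_map_def half_plane_partner_def)
  qed
  show "f \<in> class_F0"
  proof -
    have "deriv half_plane_map z \<noteq> 0" if "z \<in> unit_disc" for z
      using that by (auto simp: half_plane_map_derivs)
    moreover have "Re (1 + z * deriv (deriv half_plane_map) z / deriv half_plane_map z) > 0" if "z \<in> unit_disc" for z
    proof -
      have nz: "1 - z \<noteq> 0" using that by auto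
      have "1 + z * deriv (deriv half_plane_map) z / deriv half_plane_map z = 1 + z * (2 / (1 - z))"
        unfolding half_plane_map_derivs(2,3)[OF that] using nz
        by (simp add: power_numeral_reduce)
      also have "\<dots> = 2 / (1 - z) - 1" using nz by (simp add: field_simps)
      finally have eq: "1 + z * deriv (deriv half_plane_map) z / deriv half_plane_map z = 2 * (1 / (1 - z)) - 1"
        by simp
      have "Re (1 / (1 - z)) > 1/2" using that nz by (subst Re_half_iff_cmod) auto
      thus ?thesis unfolding eq by (simp del: times_divide_eq_right)
    qed
    moreover have "Moebius_function 0 (- of_real r) \<in> Aut_disc"
      using r by (auto simp: Aut_disc_def intro!: exI[of _ 0] exI[of _ "- complex_of_real r"])
    moreover have "deriv (half_plane_partner r) z / deriv half_plane_map z = Moebius_function 0 (- of_real r) z"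
      if "z \<in> unit_disc" for z
      using that by (auto simp: half_plane_map_derivs DERIV_imp_deriv[OF dg])
    ultimately show ?thesis unfolding class_F0_def class_H_def using dec by blast
  qed
  show "power_series_coeffs half_plane_map (half_plane_partner r) (\<lambda>_. 1)
       (\<lambda>n. of_real (half_plane_partner_coeff r n))"
    unfolding power_series_coeffs_def
  proof (intro conjI ballI)
    fix z :: complex assume z: "z \<in> unit_disc"
    have "(\<lambda>n. z\<^sup>2 * z ^ n) sums (z\<^sup>2 * (1 / (1 - z)))"
      using z by (intro sums_mult geometric_sums) auto
    moreover have "1 - z \<noteq> 0" using z by auto
    hence "z\<^sup>2 * (1 / (1 - z)) = half_plane_map z - z"
      by (simp add: half_plane_map_def field_simps power2_eq_square)
    ultimately show "(\<lambda>n. 1 * z ^ (n + 2)) sums (half_plane_map z - z)"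
      by (simp add: power2_eq_square mult_ac)
    show "(\<lambda>n. of_real (half_plane_partner_coeff r (n + 1)) * z ^ (n + 1)) sums half_plane_partner r z"
      by (rule half_plane_partner_sums[OF z r])
  qed
qed

theorem theorem4p3:
  shows "(\<forall>f h g a b.
            f \<in> class_F0 \<and> harmonic_decomp f h g \<and> power_series_coeffs h g a b \<longrightarrow>
            (\<forall>n\<ge>1. cmod (b n) \<le> 1)) \<and>
         (\<forall>n\<ge>1. \<forall>C::real. C < 1 \<longrightarrow>
            \<not> (\<forall>f h g a b.
                  f \<in> class_F0 \<and> harmonic_decomp f h g \<and> power_series_coeffs h g a b \<longrightarrow>
                  cmod (b n) \<le> C))"
proof (intro conjI allI impI notI)
  fix f h g :: "complex \<Rightarrow> complex" and a b :: "nat \<Rightarrow> complex" and n :: nat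
  assume "f \<in> class_F0 \<and> harmonic_decomp f h g \<and> power_series_coeffs h g a b" "n \<ge> 1"
  thus "cmod (b n) \<le> 1" using class_F0_coeff_bound by blast
next
  fix n :: nat and C :: real
  assume n: "n \<ge> 1" and C: "C < 1"
    and all: "\<forall>f h g a b. f \<in> class_F0 \<and> harmonic_decomp f h g \<and> power_series_coeffs h g a b \<longrightarrow>
                  cmod (b n) \<le> C"
  \<comment> \<open>any \<open>r\<close> in \<open>[0, 1)\<close> beyond \<open>C\<close> will do; the maximum covers negative \<open>C\<close>\<close>
  define r where "r = (1 + max C 0) / 2"
  have r: "0 \<le> r" "r < 1" "C < r" using C by (auto simp: r_def max_def)
  have "cmod (of_real (half_plane_partner_coeff r n)) \<le> C"
    using all half_plane_example[OF r(1,2)] by blast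
  with half_plane_partner_coeff_ge[OF r(1,2) n] r(3) show False by simp
qed

end
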